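(* Let $m<n$ be positive integers, $A\in\mathbb{R}^{m\times n}$, $b\in\mathbb{R}^m$, $c\in\mathbb{R}^n$, and consider the linear program $$\min\ c^{\top}x\quad\text{subject to}\quad Ax=b,\ x\ge 0 .$$ Assume that (i) $\operatorname{rank}A=m$ and every column of $A$ is nonzero; (ii) this problem and its dual $\max\{b^{\top}y : A^{\top}y+s=c,\ s\ge 0\}$ have optimal basic solutions $x^*$ and $(y^*,s^* )$, respectively, with common optimal value $z^*$; (iii) an initial basic feasible solution (BFS) $x^0$ is given which is not optimal, i.e. $c^{\top}x^0>z^*$. Let $\gamma$ and $\delta$ be the maximum and minimum positive elements over all BFSs, and let $\beta=\min_{j}\|a_j\|/\max_{j}\|a_j\|$ where $a_j$ is the $j$-th column of $A$. Then the simplex method with the largest distance rule, started from $x^0$, generates at most $$(n-m)\left\lceil \frac{m\gamma}{\beta\delta}\,\log\left(\frac{m\gamma}{\delta}\right)\right\rceil$$ different BFSs (the initial BFS $x^0$ not being counted).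
   Context: Notation: $\|\cdot\|$ is the Euclidean norm, $\log$ is the natural logarithm, and for a real number $r$, $\lceil r\rceil$ denotes the minimum integer greater than $r$ (strictly greater, so $\lceil 0\rceil=1$). Bases and dictionaries: a set $B\subset\{1,\dots,n\}$ with $|B|=m$ and $A_B$ (the columns of $A$ indexed by $B$) nonsingular is a basis, and $N=\{1,\dots,n\}\setminus B$ is the corresponding nonbasis. The dictionary for $B$ is: minimize $c_B^{\top}A_B^{-1}b+\bar{c}_N^{\top}x_N$ subject to $x_B=A_B^{-1}b-\bar{A}_Nx_N$, $x\ge0$, where $\bar{c}_N=c_N-A_N^{\top}(A_B^{\top})^{-1}c_B$ is the reduced cost vector and $\bar{A}_N=A_B^{-1}A_N$. The basic solution of $B$ is $(x_B,x_N)=(A_B^{-1}b,0)$; it is a basic feasible solution (BFS) if $x_B\ge0$, in which case $B$ is called a feasible basis. Simplex method: starting from a feasible basis whose BFS is $x^0$, at iteration $t$ with basis $B^t$, nonbasis $N^t$ and BFS $x^t$: if $\bar{c}_{N^t}\ge0$, stop ($x^t$ is optimal). Otherwise choose an entering variable $x_j$, $j\in N^t$, with $\bar{c}_j<0$ by the pivoting rule; increase $x_j$ from $0$, keeping the other nonbasic variables at $0$, as far as feasibility permits; if it can be increased infinitely, the problem is unbounded; otherwise some basic variable $x_i$ becomes zero and blocks further increase, and $x_i$ and $x_j$ are exchanged (ties for the leaving variable are broken arbitrarily), giving $B^{t+1}$ and the BFS $x^{t+1}$. In the degenerate case $x^{t+1}=x^t$ is possible, and no nondegeneracy or anti-cycling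 assumption is made. Largest distance rule: the entering index is any $j\in\arg\min\{\bar{c}_j/\|a_j\| : j\in N^t\}$, where $a_j$ is the $j$-th column of $A$ (not of $\bar{A}_N$). Parameters: $\delta$ (resp. $\gamma$) is the minimum (resp. maximum) of all positive entries occurring in any BFS of the problem. Counting: "the number of different BFSs generated" counts the distinct solution vectors $x^t$ other than the initial $x^0$ visited during the run; it equals the number of indices $t$ with $x^{t+1}\ne x^t$. *)

theory Defs
  imports "HOL-Analysis.Analysis"
begin

text \<open>
  The linear program is: minimize \<open>c \<bullet> x\<close> subject to \<open>A *v x = b\<close>, \<open>x \<ge> 0\<close>, with
  \<open>A :: real^'n^'m\<close>, so that \<open>CARD('m)\<close> is the number of rows and \<open>CARD('n)\<close> the number of columns.
\<close>

definition lp_feasible :: "real^'n^'m \<Rightarrow> real^'m \<Rightarrow> real^'n \<Rightarrow> bool" where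
  "lp_feasible A b x \<longleftrightarrow> A *v x = b \<and> (\<forall>j. 0 \<le> x $ j)"

definition lp_optimal :: "real^'n^'m \<Rightarrow> real^'m \<Rightarrow> real^'n \<Rightarrow> real^'n \<Rightarrow> bool" where
  "lp_optimal A b c x \<longleftrightarrow> lp_feasible A b x \<and> (\<forall>x'. lp_feasible A b x' \<longrightarrow> c \<bullet> x \<le> c \<bullet> x')"

definition dual_feasible :: "real^'n^'m \<Rightarrow> real^'n \<Rightarrow> real^'m \<Rightarrow> real^'n \<Rightarrow> bool" where
  "dual_feasible A c y s \<longleftrightarrow> transpose A *v y + s = c \<and> (\<forall>j. 0 \<le> s $ j)"

definition dual_optimal :: "real^'n^'m \<Rightarrow> real^'m \<Rightarrow> real^'n \<Rightarrow> real^'m \<Rightarrow> real^'n \<Rightarrow> bool" where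
  "dual_optimal A b c y s \<longleftrightarrow>
     dual_feasible A c y s \<and> (\<forall>y' s'. dual_feasible A c y' s' \<longrightarrow> b \<bullet> y' \<le> b \<bullet> y)"

text \<open>
  A basis is a set \<open>B\<close> of column indices. To treat \<open>A\<^sub>B\<close> as a square matrix, its columns are indexed
  by \<open>'m\<close> through an arbitrary fixed enumeration of \<open>B\<close>. The choice only permutes the columns of
  \<open>A\<^sub>B\<close> and the entries of vectors indexed by \<open>B\<close>; it affects none of the notions that follow
  \<open>is_basis\<close>. If \<open>card B \<noteq> CARD('m)\<close> no enumeration exists and the value is meaningless.
\<close>

definition basis_enum :: "'n::finite set \<Rightarrow> 'm::finite \<Rightarrow> 'n" where
  "basis_enum B = (SOME e. bij_betw e UNIV B)"

definition basis_matrix :: "real^'n^'m \<Rightarrow> 'n set \<Rightarrow> real^'m^'m" where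
  "basis_matrix A B = (\<chi> i k. A $ i $ basis_enum B k)"

definition basis_cost :: "real^'n \<Rightarrow> 'n set \<Rightarrow> real^'m" where
  "basis_cost c B = (\<chi> k. c $ basis_enum B k)"

text \<open>The component of \<open>v\<close> (indexed by \<open>B\<close> through the enumeration) that belongs to \<open>j \<in> B\<close>.\<close>

definition basis_nth :: "'n::finite set \<Rightarrow> real^'m \<Rightarrow> 'n \<Rightarrow> real" where
  "basis_nth B v j = v $ inv (basis_enum B) j"

definition is_basis :: "real^'n^'m \<Rightarrow> 'n set \<Rightarrow> bool" where
  "is_basis A B \<longleftrightarrow> card B = CARD('m) \<and> invertible (basis_matrix A B)"

definition basic_solution :: "real^'n^'m \<Rightarrow> real^'m \<Rightarrow> 'n set \<Rightarrow> real^'n" where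
  "basic_solution A b B =
     (\<chi> j. if j \<in> B then basis_nth B (matrix_inv (basis_matrix A B) *v b) j else 0)"

definition feasible_basis :: "real^'n^'m \<Rightarrow> real^'m \<Rightarrow> 'n set \<Rightarrow> bool" where
  "feasible_basis A b B \<longleftrightarrow> is_basis A B \<and> (\<forall>j. 0 \<le> basic_solution A b B $ j)"

definition bfs :: "real^'n^'m \<Rightarrow> real^'m \<Rightarrow> (real^'n) set" where
  "bfs A b = basic_solution A b ` {B. feasible_basis A b B}"

definition dual_basic_y :: "real^'n^'m \<Rightarrow> real^'n \<Rightarrow> 'n set \<Rightarrow> real^'m" where
  "dual_basic_y A c B = matrix_inv (transpose (basis_matrix A B)) *v basis_cost c B"

text \<open>
  Formed for all indices at once: \<open>c - A\<^sup>T (A\<^sub>B\<^sup>T)\<inverse> c\<^sub>B\<close>. The components outside \<open>B\<close> are the reduced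
  cost vector, those in \<open>B\<close> vanish.
\<close>

definition reduced_cost :: "real^'n^'m \<Rightarrow> real^'n \<Rightarrow> 'n set \<Rightarrow> real^'n" where
  "reduced_cost A c B = c - transpose A *v dual_basic_y A c B"

definition dual_basic_solution ::
    "real^'n^'m \<Rightarrow> real^'n \<Rightarrow> real^'m \<Rightarrow> real^'n \<Rightarrow> bool" where
  "dual_basic_solution A c y s \<longleftrightarrow>
     (\<exists>B. is_basis A B \<and> y = dual_basic_y A c B \<and> s = reduced_cost A c B)"

text \<open>
  The point obtained from the dictionary for \<open>B\<close> by giving the nonbasic variable \<open>j\<close> the value
  \<open>\<theta>\<close> and all other nonbasic variables the value \<open>0\<close>, i.e. \<open>x\<^sub>B = A\<^sub>B\<inverse> b - \<theta> A\<^sub>B\<inverse> a\<^sub>j\<close>.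
\<close>

definition edge_point ::
    "real^'n^'m \<Rightarrow> real^'m \<Rightarrow> 'n set \<Rightarrow> 'n \<Rightarrow> real \<Rightarrow> real^'n" where
  "edge_point A b B j \<theta> =
     (\<chi> k. if k \<in> B
           then basis_nth B (matrix_inv (basis_matrix A B) *v b
                  - \<theta> *\<^sub>R (matrix_inv (basis_matrix A B) *v column j A)) k
           else if k = j then \<theta> else 0)"

text \<open>
  A pivoting rule \<open>R\<close> is a relation: \<open>R B j\<close> means that \<open>j\<close> may be chosen as entering index at \<open>B\<close>.
\<close>

definition entering :: "real^'n^'m \<Rightarrow> real^'n \<Rightarrow> ('n set \<Rightarrow> 'n \<Rightarrow> bool) \<Rightarrow> 'n set \<Rightarrow> 'n \<Rightarrow> bool" where
  "entering A c R B j \<longleftrightarrow> j \<notin> B \<and> reduced_cost A c B $ j < 0 \<and> R B j"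

definition largest_distance_rule :: "real^'n^'m \<Rightarrow> real^'n \<Rightarrow> 'n set \<Rightarrow> 'n \<Rightarrow> bool" where
  "largest_distance_rule A c B j \<longleftrightarrow>
     is_arg_min (\<lambda>j. reduced_cost A c B $ j / norm (column j A)) (\<lambda>j. j \<notin> B) j"

text \<open>
  \<open>\<theta>\<close> is the largest value of the entering variable \<open>j\<close> that keeps the point feasible, and the leaving
  variable \<open>i\<close> is any basic variable that is zero there and blocks a further increase.
\<close>

definition simplex_pivot ::
    "('n set \<Rightarrow> 'n \<Rightarrow> bool) \<Rightarrow> real^'n^'m \<Rightarrow> real^'m \<Rightarrow> real^'n \<Rightarrow> 'n set \<Rightarrow> 'n set \<Rightarrow> bool" where
  "simplex_pivot R A b c B B' \<longleftrightarrow>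
     (\<exists>j \<theta> i. entering A c R B j \<and> 0 \<le> \<theta> \<and>
        (\<forall>k. 0 \<le> edge_point A b B j \<theta> $ k) \<and>
        i \<in> B \<and> edge_point A b B j \<theta> $ i = 0 \<and>
        (\<forall>\<theta>'>\<theta>. edge_point A b B j \<theta>' $ i < 0) \<and>
        B' = insert j (B - {i}))"

definition simplex_stop ::
    "('n set \<Rightarrow> 'n \<Rightarrow> bool) \<Rightarrow> real^'n^'m \<Rightarrow> real^'m \<Rightarrow> real^'n \<Rightarrow> 'n set \<Rightarrow> bool" where
  "simplex_stop R A b c B \<longleftrightarrow>
     (\<forall>j. j \<notin> B \<longrightarrow> 0 \<le> reduced_cost A c B $ j) \<or>
     (\<exists>j. entering A c R B j \<and> (\<forall>\<theta>\<ge>0. \<forall>k. 0 \<le> edge_point A b B j \<theta> $ k))"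

text \<open>
  A complete run of the simplex method from the BFS \<open>x\<^sub>0\<close>: the bases \<open>Bs 0, Bs 1, \<dots>\<close> are visited
  and \<open>T\<close> is the number of iterations; \<open>T = \<infinity>\<close> (cycling) is allowed. Values \<open>Bs t\<close> with \<open>t > T\<close>
  are irrelevant. Several bases may have the BFS \<open>x\<^sub>0\<close>; any of them may be the initial one.
\<close>

definition simplex_run ::
    "('n set \<Rightarrow> 'n \<Rightarrow> bool) \<Rightarrow> real^'n^'m \<Rightarrow> real^'m \<Rightarrow> real^'n \<Rightarrow> real^'n \<Rightarrow> enat \<Rightarrow> (nat \<Rightarrow> 'n set) \<Rightarrow> bool"
  where
  "simplex_run R A b c x\<^sub>0 T Bs \<longleftrightarrow>
     feasible_basis A b (Bs 0) \<and> basic_solution A b (Bs 0) = x\<^sub>0 \<and>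
     (\<forall>t. enat t < T \<longrightarrow> simplex_pivot R A b c (Bs t) (Bs (Suc t))) \<and>
     (\<forall>t. enat t = T \<longrightarrow> simplex_stop R A b c (Bs t))"

definition generated_bfs ::
    "real^'n^'m \<Rightarrow> real^'m \<Rightarrow> real^'n \<Rightarrow> enat \<Rightarrow> (nat \<Rightarrow> 'n set) \<Rightarrow> (real^'n) set" where
  "generated_bfs A b x\<^sub>0 T Bs = {basic_solution A b (Bs t) | t. enat t \<le> T} - {x\<^sub>0}"

definition bfs_max :: "real^'n^'m \<Rightarrow> real^'m \<Rightarrow> real" where
  "bfs_max A b = Max {x $ j | x j. x \<in> bfs A b \<and> 0 < x $ j}"

definition bfs_min :: "real^'n^'m \<Rightarrow> real^'m \<Rightarrow> real" where
  "bfs_min A b = Min {x $ j | x j. x \<in> bfs A b \<and> 0 < x $ j}"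

definition column_ratio :: "real^'n^'m \<Rightarrow> real" where
  "column_ratio A = Min (range (\<lambda>j. norm (column j A))) / Max (range (\<lambda>j. norm (column j A)))"

text \<open>The minimum integer strictly greater than \<open>r\<close>; unlike \<open>ceiling\<close>, it maps \<open>0\<close> to \<open>1\<close>.\<close>

definition strict_ceiling :: "real \<Rightarrow> int" where
  "strict_ceiling r = (LEAST k. r < of_int k)"

lemma strict_ceiling_eq: "strict_ceiling r = \<lfloor>r\<rfloor> + 1"
  unfolding strict_ceiling_def by (rule Least_equality) linarith+

end

theory Submission
  imports Defs
begin

text \<open>
  The bound follows from playing two estimates of the optimality gap \<open>c \<bullet> x - z\<^sup>*\<close> against each other.
  Write \<open>m\<close> for the number of rows, \<open>\<gamma>\<close> and \<open>\<delta>\<close> for the largest and smallest positive entry of a BFS,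
  and \<open>\<beta>\<close> for the column ratio.

  \<^emph>\<open>The gap contracts.\<close> By the choice of the entering index \<open>j\<close>, every reduced cost is at least
  \<open>-d \<parallel>a\<^sub>k\<parallel>\<close>, where \<open>d = -r\<^sub>j / \<parallel>a\<^sub>j\<parallel>\<close> and \<open>r\<^sub>j\<close> is the reduced cost of \<open>j\<close>. Since the entries of an
  optimal BFS add up to at most \<open>m \<gamma>\<close>, the gap is at most \<open>d m \<gamma>\<close> times the largest column norm. A pivot
  that moves the BFS gives the entering variable a positive value, hence one that is at least \<open>\<delta>\<close>, and so
  gains at least \<open>d \<delta>\<close> times the smallest column norm. Every such pivot therefore multiplies the gap by
  at most \<open>1 - \<beta>\<delta>/(m\<gamma>)\<close> (\<open>pivot_contracts_gap\<close>).

  \<^emph>\<open>A witness index keeps the gap large.\<close> By duality the gap at \<open>x\<close> equals \<open>s\<^sup>* \<bullet> x\<close>, a sum of at most \<open>m\<close>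
  nonzero terms, so some index \<open>j\<close> with \<open>x\<^sub>j > 0\<close> carries at least the fraction \<open>1/m\<close> of it
  (\<open>dominant_index\<close>). This \<open>j\<close> has \<open>s\<^sup>*\<^sub>j > 0\<close> and so is one of the \<open>n - m\<close> indices outside the optimal
  dual basis. If the same \<open>j\<close> has a positive entry at a second BFS, then the gap there is at least
  \<open>\<delta>/(m\<gamma>)\<close> times the gap at \<open>x\<close> (\<open>gap_ratio_at_common_index\<close>).

  Attach such a witness to each moving pivot. Once \<open>K\<close> moving pivots have taken place, where
  \<open>K > (m\<gamma>/(\<beta>\<delta>)) ln (m\<gamma>/\<delta>)\<close>, the gap has shrunk by more than the factor \<open>\<delta>/(m\<gamma>)\<close>. So each index is the witness of at most \<open>K\<close>
  moving pivots, and there are at most \<open>(n - m) K\<close> of them. Each generated BFS other than the initial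
  one is the result of a moving pivot.
\<close>

section \<open>Bases and solutions supported on them\<close>

text \<open>
  Extending a vector over the basis by zero identifies \<open>A\<^sub>B\<close> with the restriction of \<open>A\<close> to the vectors
  supported on \<open>B\<close> (\<open>matrix_mult_spread\<close>). Being a basis then no longer refers to an enumeration
  (\<open>is_basis_iff_kernel_trivial\<close>), so that bases that differ by an exchange of indices can be compared.
\<close>

definition spread :: "'n::finite set \<Rightarrow> real^'m::finite \<Rightarrow> real^'n" where
  "spread B v = (\<chi> k. if k \<in> B then basis_nth B v k else 0)"

lemma bij_basis_enum:
  fixes B :: "'n::finite set"
  assumes "card B = CARD('m::finite)"
  shows "bij_betw (basis_enum B :: 'm \<Rightarrow> 'n) UNIV B"
proof -
  have "\<exists>e :: 'm \<Rightarrow> 'n. bij_betw e UNIV B"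
    using assms by (intro finite_same_card_bij) auto
  then show ?thesis
    unfolding basis_enum_def by (rule someI_ex)
qed

lemma basis_enum_in:
  fixes B :: "'n::finite set"
  assumes "card B = CARD('m::finite)"
  shows "basis_enum B (l :: 'm) \<in> B"
  using bij_basis_enum[OF assms] by (auto simp: bij_betw_def)

lemma spread_enum:
  fixes v :: "real^'m" and B :: "'n::finite set"
  assumes "card B = CARD('m)"
  shows "spread B v $ basis_enum B (l :: 'm) = v $ l"
proof -
  have "inj (basis_enum B :: 'm \<Rightarrow> 'n)"
    using bij_basis_enum[OF assms] by (simp add: bij_betw_def)
  then show ?thesis
    using basis_enum_in[OF assms, of l] by (simp add: spread_def basis_nth_def)
qed

lemma spread_restrict:
  fixes x :: "real^'n"
  assumes card: "card B = CARD('m::finite)" and supp: "\<And>k. k \<notin> B \<Longrightarrow> x $ k = 0"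
  shows "spread B (\<chi> l::'m. x $ basis_enum B l) = x"
proof -
  have "basis_enum B (inv (basis_enum B) k :: 'm) = k" if "k \<in> B" for k
    using bij_basis_enum[OF card] that by (auto simp: bij_betw_def intro!: f_inv_into_f)
  then show ?thesis
    using supp by (auto simp: vec_eq_iff spread_def basis_nth_def)
qed

lemma matrix_mult_spread:
  fixes A :: "real^'n^'m"
  assumes "card B = CARD('m)"
  shows "A *v spread B v = basis_matrix A B *v v"
proof -
  have "(\<Sum>k\<in>UNIV. A $ i $ k * spread B v $ k) = (\<Sum>l\<in>UNIV. A $ i $ basis_enum B l * v $ l)" for i
  proof -
    have "(\<Sum>k\<in>UNIV. A $ i $ k * spread B v $ k) = (\<Sum>k\<in>B. A $ i $ k * spread B v $ k)"
      by (rule sum.mono_neutral_right) (auto simp: spread_def)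
    also have "\<dots> = (\<Sum>l\<in>UNIV. A $ i $ basis_enum B (l :: 'm) * spread B v $ basis_enum B l)"
      using sum.reindex_bij_betw[OF bij_basis_enum[OF assms], of "\<lambda>k. A $ i $ k * spread B v $ k"]
      by simp
    finally show ?thesis
      by (simp add: spread_enum[OF assms])
  qed
  then show ?thesis
    by (simp add: vec_eq_iff matrix_vector_mult_def basis_matrix_def)
qed

lemma matrix_inv_mult_vec:
  fixes M :: "real^'m^'m"
  assumes "invertible M"
  shows "M *v (matrix_inv M *v v) = v" and "matrix_inv M *v (M *v v) = v"
proof -
  have "M ** matrix_inv M = mat 1 \<and> matrix_inv M ** M = mat 1"
    using assms unfolding invertible_def matrix_inv_def by (rule someI_ex)
  then show "M *v (matrix_inv M *v v) = v" "matrix_inv M *v (M *v v) = v"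
    by (simp_all add: matrix_vector_mul_assoc)
qed

lemma is_basis_iff_kernel_trivial:
  fixes A :: "real^'n^'m"
  shows "is_basis A B \<longleftrightarrow>
    card B = CARD('m) \<and> (\<forall>x. (\<forall>k. k \<notin> B \<longrightarrow> x $ k = 0) \<and> A *v x = 0 \<longrightarrow> x = 0)"
proof (cases "card B = CARD('m)")
  case card: True
  have "invertible (basis_matrix A B) \<longleftrightarrow> (\<forall>v. basis_matrix A B *v v = 0 \<longrightarrow> v = 0)"
    by (simp add: invertible_left_inverse matrix_left_invertible_ker)
  also have "\<dots> \<longleftrightarrow> (\<forall>x. (\<forall>k. k \<notin> B \<longrightarrow> x $ k = 0) \<and> A *v x = 0 \<longrightarrow> x = 0)"
  proof (intro iffI allI impI)
    fix x :: "real^'n"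
    assume ker: "\<forall>v. basis_matrix A B *v v = 0 \<longrightarrow> v = 0"
      and x: "(\<forall>k. k \<notin> B \<longrightarrow> x $ k = 0) \<and> A *v x = 0"
    let ?v = "\<chi> l::'m. x $ basis_enum B l"
    have sx: "spread B ?v = x"
      using x by (intro spread_restrict[OF card]) auto
    then have "?v = 0"
      using ker x matrix_mult_spread[OF card, of A ?v] by auto
    then show "x = 0"
      by (subst sx[symmetric]) (simp add: vec_eq_iff spread_def basis_nth_def)
  next
    fix v :: "real^'m"
    assume ker: "\<forall>x. (\<forall>k. k \<notin> B \<longrightarrow> x $ k = 0) \<and> A *v x = 0 \<longrightarrow> x = 0"
      and v: "basis_matrix A B *v v = 0"
    have "spread B v = 0"
      using ker v matrix_mult_spread[OF card, of A v] by (auto simp: spread_def)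
    then show "v = 0"
      using spread_enum[OF card, of v] by (simp add: vec_eq_iff)
  qed
  finally show ?thesis
    using card by (simp add: is_basis_def)
qed (simp add: is_basis_def)

lemma basic_solution_spread:
  "basic_solution A b B = spread B (matrix_inv (basis_matrix A B) *v b)"
  by (simp add: basic_solution_def spread_def)

lemma basic_solution_supp: "k \<notin> B \<Longrightarrow> basic_solution A b B $ k = 0"
  by (simp add: basic_solution_def)

lemma basic_solution_solves:
  assumes "is_basis A B"
  shows "A *v basic_solution A b B = b"
  using assms by (simp add: is_basis_def basic_solution_spread matrix_mult_spread matrix_inv_mult_vec)

lemma basic_solution_unique:
  assumes B: "is_basis A B" and "A *v x = b" and "\<And>k. k \<notin> B \<Longrightarrow> x $ k = 0"
  shows "x = basic_solution A b B"
proof -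
  have "A *v (x - basic_solution A b B) = 0"
    using assms by (simp add: matrix_vector_mult_diff_distrib basic_solution_solves)
  moreover have "(x - basic_solution A b B) $ k = 0" if "k \<notin> B" for k
    using assms(3) that by (simp add: basic_solution_supp)
  ultimately have "x - basic_solution A b B = 0"
    using B unfolding is_basis_iff_kernel_trivial by blast
  then show ?thesis by simp
qed

section \<open>Reduced costs\<close>

lemma reduced_cost_basic:
  fixes A :: "real^'n^'m"
  assumes B: "is_basis A B" and k: "k \<in> B"
  shows "reduced_cost A c B $ k = 0"
proof -
  let ?M = "basis_matrix A B" and ?y = "dual_basic_y A c B"
  have card: "card B = CARD('m)" and inv: "invertible ?M"
    using B by (auto simp: is_basis_def)
  obtain l :: 'm where l: "k = basis_enum B l"
    using bij_basis_enum[OF card] k by (auto simp: bij_betw_def)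
  have "transpose ?M *v ?y = basis_cost c B"
    unfolding dual_basic_y_def by (rule matrix_inv_mult_vec(1)[OF transpose_invertible[OF inv]])
  then have "(transpose ?M *v ?y) $ l = c $ k"
    by (simp add: basis_cost_def l)
  moreover have "(transpose ?M *v ?y) $ l = (transpose A *v ?y) $ k"
    by (simp add: matrix_vector_mult_def transpose_def basis_matrix_def l)
  ultimately show ?thesis
    by (simp add: reduced_cost_def)
qed

lemma inner_cost_dual_decomposition:
  fixes A :: "real^'n^'m"
  assumes "A *v x = b" and "transpose A *v y + s = c"
  shows "c \<bullet> x = b \<bullet> y + s \<bullet> x"
proof -
  have "(transpose A *v y) \<bullet> x = y \<bullet> (A *v x)"
    by (metis dot_lmul_matrix vector_transpose_matrix transpose_transpose)
  then show ?thesis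
    unfolding assms(1) assms(2)[symmetric] inner_add_left by (simp add: inner_commute)
qed

lemma cost_relative_to_basic_solution:
  fixes A :: "real^'n^'m"
  assumes B: "is_basis A B" and x: "A *v x = b"
  shows "c \<bullet> x = c \<bullet> basic_solution A b B + reduced_cost A c B \<bullet> x"
proof -
  let ?r = "reduced_cost A c B"
  have dec: "transpose A *v dual_basic_y A c B + ?r = c"
    by (simp add: reduced_cost_def)
  have "?r $ k * basic_solution A b B $ k = 0" for k
    using reduced_cost_basic[OF B] basic_solution_supp[of k B A b] by (cases "k \<in> B") auto
  then have "?r \<bullet> basic_solution A b B = 0"
    unfolding inner_vec_def inner_real_def by (rule sum.neutral[OF ballI])
  then show ?thesis
    using inner_cost_dual_decomposition[OF x dec]
      inner_cost_dual_decomposition[OF basic_solution_solves[OF B, of b] dec] by simp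
qed

section \<open>The effect of a pivot\<close>

lemma edge_direction:
  fixes A :: "real^'n^'m"
  assumes B: "is_basis A B" and j: "j \<notin> B"
  obtains d where "A *v d = 0" and "d $ j = 1" and "\<And>k. k \<notin> insert j B \<Longrightarrow> d $ k = 0"
    and "\<And>\<theta>. edge_point A b B j \<theta> = basic_solution A b B + \<theta> *\<^sub>R d"
proof
  let ?w = "matrix_inv (basis_matrix A B) *v column j A"
  let ?d = "axis j 1 - spread B ?w"
  have "A *v axis j 1 = column j A"
    by (simp add: matrix_vector_mult_basis)
  then show "A *v ?d = 0"
    using B by (simp add: is_basis_def matrix_vector_mult_diff_distrib matrix_mult_spread
        matrix_inv_mult_vec)
  show "?d $ j = 1"
    using j by (simp add: spread_def)
  show "?d $ k = 0" if "k \<notin> insert j B" for k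
    using that by (simp add: spread_def axis_def)
  show "edge_point A b B j \<theta> = basic_solution A b B + \<theta> *\<^sub>R ?d" for \<theta>
    using j by (auto simp: vec_eq_iff edge_point_def basic_solution_def spread_def basis_nth_def
        axis_def)
qed

text \<open>
  That the new index set is again a basis rests on the blocking condition: a vector in the kernel of
  \<open>A\<close> supported on the new set is a multiple of the edge direction, which has a nonzero entry at the
  leaving index.
\<close>

lemma pivot_step:
  fixes A :: "real^'n^'m"
  assumes fB: "feasible_basis A b B" and piv: "simplex_pivot R A b c B B'"
  obtains j where "entering A c R B j" and "feasible_basis A b B'"
    and "c \<bullet> basic_solution A b B' =
      c \<bullet> basic_solution A b B + reduced_cost A c B $ j * basic_solution A b B' $ j"
    and "basic_solution A b B' \<noteq> basic_solution A b B \<Longrightarrow> 0 < basic_solution A b B' $ j"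
proof -
  have B: "is_basis A B"
    using fB by (simp add: feasible_basis_def)
  obtain j \<theta> i where ent: "entering A c R B j" and \<theta>: "0 \<le> \<theta>"
    and nonneg: "\<forall>k. 0 \<le> edge_point A b B j \<theta> $ k"
    and i: "i \<in> B" "edge_point A b B j \<theta> $ i = 0" "\<forall>\<theta>'>\<theta>. edge_point A b B j \<theta>' $ i < 0"
    and B': "B' = insert j (B - {i})"
    using piv unfolding simplex_pivot_def by blast
  have j: "j \<notin> B"
    using ent by (simp add: entering_def)
  obtain d where d: "A *v d = 0" "d $ j = 1" "\<And>k. k \<notin> insert j B \<Longrightarrow> d $ k = 0"
    and edge: "\<And>\<theta>. edge_point A b B j \<theta> = basic_solution A b B + \<theta> *\<^sub>R d"
    using edge_direction[OF B j] by metis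
  define x where "x = edge_point A b B j \<theta>"
  have "edge_point A b B j (\<theta> + 1) $ i < 0"
    using i(3) by simp
  then have di: "d $ i < 0"
    using i(2) by (simp add: edge algebra_simps)
  have "x' = 0" if supp: "\<forall>k. k \<notin> B' \<longrightarrow> x' $ k = 0" and ker: "A *v x' = 0" for x'
  proof -
    let ?y = "x' - x' $ j *\<^sub>R d"
    have "?y $ k = 0" if "k \<notin> B" for k
      using supp d(2,3) that by (cases "k = j") (auto simp: B')
    moreover have "A *v ?y = 0"
      using ker d(1) by (simp add: matrix_vector_mult_diff_distrib matrix_vector_mult_scaleR)
    ultimately have y0: "?y = 0"
      using B unfolding is_basis_iff_kernel_trivial by blast
    have "x' $ i = 0"
      using supp i(1) j by (auto simp: B')
    moreover have "?y $ i = 0"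
      unfolding y0 by simp
    ultimately have "x' $ j = 0"
      using di by simp
    with y0 show ?thesis
      by (simp only: scaleR_zero_left diff_zero)
  qed
  moreover have "card B' = CARD('m)"
    using B i(1) j by (simp add: B' is_basis_def card_Suc_Diff1)
  ultimately have basis': "is_basis A B'"
    by (auto simp: is_basis_iff_kernel_trivial)
  have Ax: "A *v x = b"
    using basic_solution_solves[OF B] d(1)
    by (simp add: x_def edge matrix_vector_right_distrib matrix_vector_mult_scaleR)
  have "x $ k = 0" if "k \<notin> B'" for k
    using that i(2) d(3) j by (cases "k = i") (auto simp: B' x_def edge basic_solution_supp)
  then have x: "x = basic_solution A b B'"
    by (rule basic_solution_unique[OF basis' Ax])
  have xj: "x $ j = \<theta>"
    using j d(2) by (simp add: x_def edge basic_solution_supp)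
  have "reduced_cost A c B $ k * x $ k = (if k = j then reduced_cost A c B $ j * \<theta> else 0)" for k
    using xj reduced_cost_basic[OF B, of k c] d(3)[of k]
    by (cases "k \<in> B") (auto simp: x_def edge basic_solution_supp j)
  then have "reduced_cost A c B \<bullet> x = reduced_cost A c B $ j * x $ j"
    by (simp add: inner_vec_def xj)
  then have cost: "c \<bullet> x = c \<bullet> basic_solution A b B + reduced_cost A c B $ j * x $ j"
    using cost_relative_to_basic_solution[OF B Ax, of c] by simp
  have pos: "0 < x $ j" if "x \<noteq> basic_solution A b B"
  proof -
    have "\<theta> \<noteq> 0"
      using that by (auto simp: x_def edge)
    then show ?thesis
      using \<theta> xj by simp
  qed
  have "feasible_basis A b B'"
    unfolding feasible_basis_def x[symmetric] x_def using basis' nonneg by blast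
  then show thesis
    by (rule that[OF ent _ cost[unfolded x] pos[unfolded x]])
qed

section \<open>Entries of basic feasible solutions\<close>

lemma finite_bfs: "finite (bfs A b)"
  by (simp add: bfs_def)

lemma basic_solution_in_bfs: "feasible_basis A b B \<Longrightarrow> basic_solution A b B \<in> bfs A b"
  by (simp add: bfs_def)

lemma bfs_nonneg: "x \<in> bfs A b \<Longrightarrow> 0 \<le> x $ j"
  by (auto simp: bfs_def feasible_basis_def)

lemma bfs_solves: "x \<in> bfs A b \<Longrightarrow> A *v x = b"
  by (auto simp: bfs_def feasible_basis_def basic_solution_solves)

lemma finite_positive_entries: "finite {x $ j | x j. x \<in> bfs A b \<and> 0 < x $ j}"
proof -
  have "{x $ j | x j. x \<in> bfs A b \<and> 0 < x $ j} \<subseteq> (\<lambda>(x, j). x $ j) ` (bfs A b \<times> UNIV)"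
    by auto
  then show ?thesis
    by (rule finite_subset) (simp add: finite_bfs)
qed

lemma positive_entry_bounds:
  assumes "x \<in> bfs A b" and "0 < x $ j"
  shows "bfs_min A b \<le> x $ j" and "x $ j \<le> bfs_max A b"
proof -
  have mem: "x $ j \<in> {x $ j | x j. x \<in> bfs A b \<and> 0 < x $ j}"
    using assms by blast
  show "bfs_min A b \<le> x $ j"
    unfolding bfs_min_def by (rule Min_le[OF finite_positive_entries mem])
  show "x $ j \<le> bfs_max A b"
    unfolding bfs_max_def by (rule Max_ge[OF finite_positive_entries mem])
qed

lemma bfs_min_pos:
  assumes "x \<in> bfs A b" and "0 < x $ j"
  shows "0 < bfs_min A b"
proof -
  have "{x $ j | x j. x \<in> bfs A b \<and> 0 < x $ j} \<noteq> {}"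
    using assms by blast
  then have "bfs_min A b \<in> {x $ j | x j. x \<in> bfs A b \<and> 0 < x $ j}"
    unfolding bfs_min_def by (rule Min_in[OF finite_positive_entries])
  then show ?thesis by auto
qed

lemma sum_bfs_le:
  fixes A :: "real^'n^'m"
  assumes "x \<in> bfs A b" and "0 \<le> bfs_max A b"
  shows "(\<Sum>k\<in>UNIV. x $ k) \<le> real CARD('m) * bfs_max A b"
proof -
  obtain B where B: "is_basis A B" "x = basic_solution A b B"
    using assms by (auto simp: bfs_def feasible_basis_def)
  have "(\<Sum>k\<in>UNIV. x $ k) = (\<Sum>k\<in>B. x $ k)"
    by (rule sum.mono_neutral_right) (auto simp: B basic_solution_supp)
  also have "\<dots> \<le> of_nat (card B) * bfs_max A b"
  proof (rule sum_bounded_above)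
    show "x $ k \<le> bfs_max A b" for k
      using positive_entry_bounds(2)[OF assms(1), of k] assms(2) by linarith
  qed
  finally show ?thesis
    using B by (simp add: is_basis_def)
qed

section \<open>The two estimates of the optimality gap\<close>

text \<open>
  The bound on the gap uses the largest column norm, because nothing is known about the columns in which
  \<open>x'\<close> is positive; the bound on the gain uses the smallest one, because nothing is known about the
  entering column. This is where the column ratio comes from.
\<close>

lemma pivot_contracts_gap:
  fixes A :: "real^'n^'m"
  assumes cols: "\<forall>j. column j A \<noteq> 0"
    and fB: "feasible_basis A b B" and piv: "simplex_pivot (largest_distance_rule A c) A b c B B'"
    and x': "x' \<in> bfs A b" and max: "0 < bfs_max A b"
    and moved: "basic_solution A b B' \<noteq> basic_solution A b B"
  shows "c \<bullet> basic_solution A b B' - c \<bullet> x' \<le>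
    (1 - column_ratio A * bfs_min A b / (real CARD('m) * bfs_max A b)) *
      (c \<bullet> basic_solution A b B - c \<bullet> x')"
proof -
  let ?x = "basic_solution A b B" and ?y = "basic_solution A b B'" and ?r = "reduced_cost A c B"
  let ?S = "real CARD('m) * bfs_max A b"
  define L where "L = Min (range (\<lambda>j. norm (column j A)))"
  define U where "U = Max (range (\<lambda>j. norm (column j A)))"
  have L: "L \<le> norm (column k A)" and U: "norm (column k A) \<le> U" for k
    unfolding L_def U_def by (auto intro: Min_le Max_ge)
  have Lpos: "0 < L"
    unfolding L_def using cols by (subst Min_gr_iff) auto
  have Upos: "0 < U"
    using L[of undefined] U[of undefined] Lpos by linarith
  have B: "is_basis A B"
    using fB by (simp add: feasible_basis_def)
  obtain j where ent: "entering A c (largest_distance_rule A c) B j" and fB': "feasible_basis A b B'"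
    and cost: "c \<bullet> ?y = c \<bullet> ?x + ?r $ j * ?y $ j"
    and pos: "?y \<noteq> ?x \<Longrightarrow> 0 < ?y $ j"
    using pivot_step[OF fB piv] by metis
  have ybfs: "?y \<in> bfs A b"
    using fB' by (rule basic_solution_in_bfs)
  define d where "d = - ?r $ j / norm (column j A)"
  have normj: "0 < norm (column j A)"
    using cols by simp
  have rj: "?r $ j = - d * norm (column j A)" and dpos: "0 < d"
    using ent normj by (auto simp: d_def entering_def divide_simps)
  have r: "- d * U \<le> ?r $ k" for k
  proof (cases "k \<in> B")
    case True
    then show ?thesis
      using reduced_cost_basic[OF B True] dpos Upos by simp
  next
    case False
    then have "\<not> ?r $ k / norm (column k A) < ?r $ j / norm (column j A)"
      using ent by (auto simp: entering_def largest_distance_rule_def is_arg_min_def)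
    then have "- d \<le> ?r $ k / norm (column k A)"
      by (simp add: d_def)
    then have "- d * norm (column k A) \<le> ?r $ k"
      using cols by (simp add: pos_le_divide_eq)
    moreover have "d * norm (column k A) \<le> d * U"
      using U[of k] dpos by simp
    ultimately show ?thesis
      by simp
  qed
  have "- d * U * ?S \<le> - d * U * (\<Sum>k\<in>UNIV. x' $ k)"
    using sum_bfs_le[OF x'] max dpos Upos by simp
  also have "\<dots> \<le> ?r \<bullet> x'"
    unfolding sum_distrib_left inner_vec_def inner_real_def
    by (intro sum_mono mult_right_mono r bfs_nonneg[OF x'])
  finally have gap: "c \<bullet> ?x - c \<bullet> x' \<le> d * U * ?S"
    using cost_relative_to_basic_solution[OF B bfs_solves[OF x'], of c] by simp
  have \<delta>: "bfs_min A b \<le> ?y $ j" "0 < bfs_min A b"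
    using positive_entry_bounds(1)[OF ybfs] bfs_min_pos[OF ybfs] pos[OF moved] by auto
  have "d * L * bfs_min A b \<le> d * norm (column j A) * ?y $ j"
    using \<delta> L[of j] dpos Lpos by (intro mult_mono) auto
  then have gain: "d * L * bfs_min A b \<le> c \<bullet> ?x - c \<bullet> ?y"
    using cost rj by simp
  let ?\<rho> = "column_ratio A * bfs_min A b / ?S"
  have \<rho>: "?\<rho> = L * bfs_min A b / (U * ?S)"
    by (simp add: column_ratio_def L_def U_def)
  have "?\<rho> * (c \<bullet> ?x - c \<bullet> x') \<le> ?\<rho> * (d * U * ?S)"
    using gap Lpos Upos \<delta>(2) max unfolding \<rho> by (intro mult_left_mono) auto
  also have "\<dots> = d * L * bfs_min A b"
    using Upos max unfolding \<rho> by (simp add: field_simps)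
  finally show ?thesis
    using gain by (simp add: algebra_simps)
qed

lemma dominant_index:
  fixes A :: "real^'n^'m" and s :: "real^'n"
  assumes x: "x \<in> bfs A b" and pos: "0 < s \<bullet> x"
  obtains j where "0 < x $ j" and "s \<bullet> x \<le> real CARD('m) * (s $ j * x $ j)"
proof -
  obtain B where B: "is_basis A B" "x = basic_solution A b B"
    using x by (auto simp: bfs_def feasible_basis_def)
  have card: "card B = CARD('m)"
    using B by (simp add: is_basis_def)
  have sum: "s \<bullet> x = (\<Sum>k\<in>B. s $ k * x $ k)"
    unfolding inner_vec_def inner_real_def
    by (rule sum.mono_neutral_right) (auto simp: B basic_solution_supp)
  have "\<exists>k\<in>B. s \<bullet> x / real CARD('m) \<le> s $ k * x $ k"
  proof (rule ccontr)
    assume "\<not> ?thesis"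
    then have "(\<Sum>k\<in>B. s $ k * x $ k) < of_nat (card B) * (s \<bullet> x / real CARD('m))"
      using card by (intro sum_bounded_above_strict) auto
    then show False
      using sum card by simp
  qed
  then obtain k where k: "s \<bullet> x / real CARD('m) \<le> s $ k * x $ k"
    by blast
  then have "0 < s $ k * x $ k"
    using pos by (smt (verit) divide_pos_pos of_nat_0_less_iff zero_less_card_finite)
  then have "0 < x $ k"
    using bfs_nonneg[OF x, of k] by (cases "x $ k = 0") auto
  moreover have "s \<bullet> x \<le> real CARD('m) * (s $ k * x $ k)"
    using k by (simp add: divide_le_eq mult.commute)
  ultimately show thesis
    using that by blast
qed

text \<open>
  Both gaps are compared with \<open>s\<^sub>j\<close>: the dominant term at \<open>x\<close> is at most \<open>s\<^sub>j\<close> times the largest positive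
  entry, while at \<open>y\<close> the single term with index \<open>j\<close> is at least \<open>s\<^sub>j\<close> times the smallest one.
\<close>

lemma gap_ratio_at_common_index:
  fixes A :: "real^'n^'m" and s :: "real^'n"
  assumes x: "x \<in> bfs A b" and y: "y \<in> bfs A b" and s: "\<forall>k. 0 \<le> s $ k"
    and dom: "s \<bullet> x \<le> real CARD('m) * (s $ j * x $ j)" and xj: "0 < x $ j" and yj: "0 < y $ j"
  shows "bfs_min A b / (real CARD('m) * bfs_max A b) * (s \<bullet> x) \<le> s \<bullet> y"
proof -
  have \<gamma>: "x $ j \<le> bfs_max A b" "0 < bfs_max A b"
    using positive_entry_bounds[OF x xj] xj by auto
  have "bfs_min A b / (real CARD('m) * bfs_max A b) * (s \<bullet> x)
      \<le> bfs_min A b / (real CARD('m) * bfs_max A b) * (real CARD('m) * (s $ j * bfs_max A b))"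
    using dom \<gamma> s bfs_min_pos[OF x xj]
    by (intro mult_left_mono order.trans[OF dom]) auto
  also have "\<dots> = s $ j * bfs_min A b"
    using \<gamma> by simp
  also have "\<dots> \<le> s $ j * y $ j"
    using s positive_entry_bounds(1)[OF y yj] by (simp add: mult_left_mono)
  also have "\<dots> \<le> s \<bullet> y"
    unfolding inner_vec_def inner_real_def
    using s bfs_nonneg[OF y] by (intro member_le_sum) auto
  finally show ?thesis .
qed

section \<open>Counting contracting steps\<close>

lemma contraction_iterate:
  fixes g :: "nat \<Rightarrow> real" and T :: enat
  assumes mono: "\<And>s. enat s < T \<Longrightarrow> g (Suc s) \<le> g s"
    and contr: "\<And>s. s \<in> C \<Longrightarrow> g (Suc s) \<le> q * g s" and "0 \<le> q"
    and "s \<le> t" and "enat t \<le> T"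
  shows "g t \<le> q ^ card (C \<inter> {s..<t}) * g s"
  using \<open>s \<le> t\<close> \<open>enat t \<le> T\<close>
proof (induction t rule: dec_induct)
  case base
  then show ?case by simp
next
  case (step t)
  have lt: "enat t < T"
    using step.prems by (metis Suc_ile_eq)
  then have IH: "g t \<le> q ^ card (C \<inter> {s..<t}) * g s"
    using step.IH by simp
  have ivl: "{s..<Suc t} = insert t {s..<t}"
    using step.hyps by auto
  show ?case
  proof (cases "t \<in> C")
    case True
    have "g (Suc t) \<le> q * (q ^ card (C \<inter> {s..<t}) * g s)"
      using contr[OF True] mult_left_mono[OF IH \<open>0 \<le> q\<close>] by linarith
    then show ?thesis
      using True by (simp add: ivl algebra_simps)
  next
    case False
    then show ?thesis
      using mono[OF lt] IH by (simp add: ivl)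
  qed
qed

text \<open>
  Among \<open>K + 1\<close> contracting steps with the same label, the first \<open>K\<close> reduce \<open>g\<close> by the factor \<open>q ^ K\<close>
  before the last one starts. This is incompatible with a lower bound \<open>\<epsilon> > q ^ K\<close> on the ratio of the
  values of \<open>g\<close> at two steps with a common label.
\<close>

lemma card_contracting_steps_le:
  fixes g :: "nat \<Rightarrow> real" and T :: enat
  assumes mono: "\<And>s. enat s < T \<Longrightarrow> g (Suc s) \<le> g s"
    and contr: "\<And>s. s \<in> C \<Longrightarrow> g (Suc s) \<le> q * g s" and q: "0 \<le> q" "q \<le> 1"
    and C: "\<And>s. s \<in> C \<Longrightarrow> enat s < T" and pos: "\<And>s. s \<in> C \<Longrightarrow> 0 < g s"
    and h: "h ` C \<subseteq> J" and J: "finite J"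
    and ratio: "\<And>s t. s \<in> C \<Longrightarrow> t \<in> C \<Longrightarrow> s \<le> t \<Longrightarrow> h s = h t \<Longrightarrow> \<epsilon> * g s \<le> g t"
    and K: "q ^ K < \<epsilon>"
  shows "finite C" and "card C \<le> card J * K"
proof -
  have fibre: "finite {t \<in> C. h t = j} \<and> card {t \<in> C. h t = j} \<le> K" for j
  proof (rule finite_if_finite_subsets_card_bdd, rule ccontr)
    fix S
    assume S: "S \<subseteq> {t \<in> C. h t = j}" "finite S" and large: "\<not> card S \<le> K"
    have ne: "S \<noteq> {}"
      using large by (cases "S = {}") simp_all
    define s where "s = Min S"
    define t where "t = Max S"
    have st: "s \<in> S" "t \<in> S"
      unfolding s_def t_def using S(2) ne by simp_all
    have "s \<le> t"
      unfolding s_def by (rule Min_le[OF S(2) st(2)])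
    have "S - {t} \<subseteq> C \<inter> {s..<t}"
      using S(1,2) by (auto simp: s_def t_def less_le)
    then have "card (S - {t}) \<le> card (C \<inter> {s..<t})"
      by (intro card_mono) auto
    then have "K \<le> card (C \<inter> {s..<t})"
      using large S(2) st(2) by simp
    then have "q ^ card (C \<inter> {s..<t}) \<le> q ^ K"
      using q by (intro power_decreasing)
    moreover have sC: "s \<in> C" "t \<in> C" "h s = h t"
      using S(1) st by auto
    moreover have "g t \<le> q ^ card (C \<inter> {s..<t}) * g s"
      using contraction_iterate[of T g C q s t] mono contr q(1) \<open>s \<le> t\<close> C[OF sC(2)] by auto
    ultimately have "\<epsilon> * g s \<le> q ^ K * g s"
      using ratio[OF sC(1,2) \<open>s \<le> t\<close> sC(3)] pos[OF sC(1)]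
      by (meson mult_right_mono order.trans less_imp_le)
    then show False
      using K pos[OF sC(1)] by simp
  qed
  have C_UN: "C = (\<Union>j\<in>J. {t \<in> C. h t = j})"
    using h by auto
  show "finite C"
    by (subst C_UN) (simp add: J fibre)
  have "card C \<le> (\<Sum>j\<in>J. card {t \<in> C. h t = j})"
    by (subst C_UN) (rule card_UN_le[OF J])
  also have "\<dots> \<le> card J * K"
    using sum_bounded_above[of J "\<lambda>j. card {t \<in> C. h t = j}" K] fibre by simp
  finally show "card C \<le> card J * K" .
qed

text \<open>
  Strict excess of \<open>K\<close> over the logarithmic bound is what makes the conclusion strict, hence the
  strict ceiling in the bound on the number of BFSs.
\<close>

lemma power_one_minus_less:
  fixes p q :: real
  assumes "0 < p" "p \<le> 1" "0 < w" and K: "1 / p * ln w < real K"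
  shows "(1 - p) ^ K < 1 / w"
proof -
  have "(1 - p) ^ K \<le> exp (- p) ^ K"
    using assms(1,2) exp_ge_add_one_self[of "- p"] by (intro power_mono) auto
  also have "\<dots> = exp (- (real K * p))"
    by (simp flip: exp_of_nat_mult)
  also have "\<dots> < exp (- ln w)"
    using K assms(1) by (simp add: field_simps)
  also have "\<dots> = 1 / w"
    using assms(3) by (simp add: exp_minus inverse_eq_divide)
  finally show ?thesis .
qed

lemma values_subset_jumps:
  fixes x :: "nat \<Rightarrow> 'a" and T :: enat
  shows "{x t | t. enat t \<le> T} - {x 0} \<subseteq> (\<lambda>t. x (Suc t)) ` {t. enat t < T \<and> x (Suc t) \<noteq> x t}"
proof
  fix y
  assume "y \<in> {x t | t. enat t \<le> T} - {x 0}"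
  then obtain t where t: "enat t \<le> T" "y = x t" "x t \<noteq> x 0"
    by auto
  have "enat t \<le> T \<longrightarrow> x t \<noteq> x 0 \<longrightarrow>
      x t \<in> (\<lambda>t. x (Suc t)) ` {t. enat t < T \<and> x (Suc t) \<noteq> x t}"
  proof (induction t)
    case (Suc t)
    then show ?case
      by (cases "x (Suc t) = x t") (auto simp: Suc_ile_eq)
  qed simp
  with t show "y \<in> (\<lambda>t. x (Suc t)) ` {t. enat t < T \<and> x (Suc t) \<noteq> x t}"
    by simp
qed

section \<open>The bound on the number of basic feasible solutions\<close>

lemma simplex_run_feasible:
  assumes "simplex_run R A b c x\<^sub>0 T Bs" and "enat t \<le> T"
  shows "feasible_basis A b (Bs t)"
  using assms(2)
proof (induction t)
  case 0
  then show ?case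
    using assms(1) by (simp add: simplex_run_def)
next
  case (Suc t)
  then have "feasible_basis A b (Bs t)" "simplex_pivot R A b c (Bs t) (Bs (Suc t))"
    using assms(1) by (auto simp: simplex_run_def Suc_ile_eq)
  then show ?case
    using pivot_step by metis
qed

theorem theorem3p2:
  fixes A :: "real^'n^'m" and b :: "real^'m" and c :: "real^'n"
    and x\<^sub>0 xs ss :: "real^'n" and ys :: "real^'m" and zs :: real
    and T :: enat and Bs :: "nat \<Rightarrow> 'n set"
  assumes "CARD('m) < CARD('n)"
    and "rank A = CARD('m)"
    and "\<forall>j. column j A \<noteq> 0"
    and "xs \<in> bfs A b" and "lp_optimal A b c xs"
    and "dual_basic_solution A c ys ss" and "dual_optimal A b c ys ss"
    and "c \<bullet> xs = zs" and "b \<bullet> ys = zs"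
    and "x\<^sub>0 \<in> bfs A b" and "c \<bullet> x\<^sub>0 > zs"
    and "simplex_run (largest_distance_rule A c) A b c x\<^sub>0 T Bs"
  shows "finite (generated_bfs A b x\<^sub>0 T Bs) \<and>
    int (card (generated_bfs A b x\<^sub>0 T Bs))
      \<le> (int CARD('n) - int CARD('m)) *
        strict_ceiling (real CARD('m) * bfs_max A b / (column_ratio A * bfs_min A b)
                        * ln (real CARD('m) * bfs_max A b / bfs_min A b))"
proof -
  let ?R = "largest_distance_rule A c"
  define \<gamma> where "\<gamma> = bfs_max A b"
  define \<delta> where "\<delta> = bfs_min A b"
  define \<beta> where "\<beta> = column_ratio A"
  define w where "w = real CARD('m) * \<gamma> / \<delta>"
  define p where "p = \<beta> / w"
  define x where "x t = basic_solution A b (Bs t)" for t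
  define g where "g t = c \<bullet> x t - zs" for t
  define C where "C = {t. enat t < T \<and> x (Suc t) \<noteq> x t}"

  have run: "simplex_pivot ?R A b c (Bs t) (Bs (Suc t))" if "enat t < T" for t
    using assms(12) that by (simp add: simplex_run_def)
  have x0: "x 0 = x\<^sub>0"
    using assms(12) by (simp add: simplex_run_def x_def)
  have fB: "feasible_basis A b (Bs t)" if "enat t \<le> T" for t
    using simplex_run_feasible[OF assms(12) that] .
  have xbfs: "x t \<in> bfs A b" if "enat t \<le> T" for t
    unfolding x_def by (rule basic_solution_in_bfs[OF fB[OF that]])

  have dual: "transpose A *v ys + ss = c" and s_nonneg: "\<forall>k. 0 \<le> ss $ k"
    using assms(7) by (auto simp: dual_optimal_def dual_feasible_def)
  have gap_dual: "c \<bullet> y - zs = ss \<bullet> y" if "y \<in> bfs A b" for y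
    using inner_cost_dual_decomposition[OF bfs_solves[OF that] dual] assms(9) by simp
  have gs: "g t = ss \<bullet> x t" if "enat t \<le> T" for t
    unfolding g_def by (rule gap_dual[OF xbfs[OF that]])

  \<comment> \<open>The positive gap at \<open>x\<^sub>0\<close> equals \<open>s\<^sup>* \<bullet> x\<^sub>0\<close>, hence \<open>x\<^sub>0\<close> is not zero and \<open>\<gamma>\<close> and \<open>\<delta>\<close> are taken over a nonempty set.\<close>
  obtain k where k: "0 < x\<^sub>0 $ k"
    using dominant_index[OF assms(10), of ss] gap_dual[OF assms(10)] assms(11) by auto
  have \<delta>pos: "0 < \<delta>" and \<delta>\<gamma>: "\<delta> \<le> \<gamma>"
    using bfs_min_pos[OF assms(10) k] positive_entry_bounds[OF assms(10) k]
    by (auto simp: \<delta>_def \<gamma>_def)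
  have \<gamma>pos: "0 < \<gamma>"
    using \<delta>pos \<delta>\<gamma> by simp
  have m1: "1 \<le> real CARD('m)"
    by (simp add: Suc_leI)
  have w1: "1 \<le> w"
    using mult_mono[OF m1 \<delta>\<gamma>] \<delta>pos by (simp add: w_def)
  have \<beta>pos: "0 < \<beta>" and \<beta>1: "\<beta> \<le> 1"
  proof -
    let ?N = "range (\<lambda>j. norm (column j A))"
    have lo: "0 < Min ?N"
      using assms(3) by (subst Min_gr_iff) auto
    have le: "Min ?N \<le> Max ?N"
      by (meson Max_ge Min_le finite finite_imageI order.trans rangeI)
    show "0 < \<beta>"
      unfolding \<beta>_def column_ratio_def using lo le by (intro divide_pos_pos) linarith+
    show "\<beta> \<le> 1"
      unfolding \<beta>_def column_ratio_def using lo le by (subst divide_le_eq_1_pos) linarith+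
  qed
  have p: "0 < p" "p \<le> 1"
    using \<beta>pos \<beta>1 w1 by (auto simp: p_def)

  define r where "r = 1 / p * ln w"
  define K where "K = nat (strict_ceiling r)"
  have "0 \<le> r"
    using p w1 by (simp add: r_def)
  then have K: "int K = strict_ceiling r"
    by (simp add: K_def strict_ceiling_eq)
  then have "r < real K"
    by (simp add: strict_ceiling_eq) linarith
  then have qK: "(1 - p) ^ K < 1 / w"
    using power_one_minus_less[of p w K] p w1 by (simp add: r_def)

  have CT: "enat t \<le> T" if "t \<in> C" for t
    using that unfolding C_def by (auto intro: less_imp_le)
  have contr: "g (Suc t) \<le> (1 - p) * g t" if "t \<in> C" for t
  proof -
    have "p = column_ratio A * bfs_min A b / (real CARD('m) * bfs_max A b)"
      by (simp add: p_def w_def \<beta>_def \<gamma>_def \<delta>_def)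
    moreover have "enat t < T" "x (Suc t) \<noteq> x t"
      using that by (auto simp: C_def)
    ultimately show ?thesis
      using pivot_contracts_gap[OF assms(3) fB run assms(4), of t] \<gamma>pos assms(8)
      by (simp add: g_def x_def \<gamma>_def)
  qed
  have g_nonneg: "0 \<le> g t" if "enat t \<le> T" for t
    using s_nonneg bfs_nonneg[OF xbfs[OF that]]
    by (auto simp: gs[OF that] inner_vec_def intro!: sum_nonneg)
  have gmono: "g (Suc t) \<le> g t" if t: "enat t < T" for t
  proof (cases "t \<in> C")
    case True
    have "(1 - p) * g t \<le> 1 * g t"
      using p g_nonneg[of t] t by (intro mult_right_mono) auto
    then show ?thesis
      using contr[OF True] by simp
  next
    case False
    then show ?thesis
      using t by (simp add: C_def g_def)
  qed
  \<comment> \<open>A moving pivot lowers the cost strictly, and the lower cost is still at least \<open>z\<^sup>*\<close>.\<close>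
  have gpos: "0 < g t" if t: "t \<in> C" for t
  proof -
    have tT: "enat t < T" and ne: "x (Suc t) \<noteq> x t"
      using t by (auto simp: C_def)
    obtain j where "entering A c ?R (Bs t) j"
      and "c \<bullet> x (Suc t) = c \<bullet> x t + reduced_cost A c (Bs t) $ j * x (Suc t) $ j"
      and "0 < x (Suc t) $ j"
      using pivot_step[OF fB run, of t] tT ne unfolding x_def by (metis less_imp_le)
    then have "g (Suc t) < g t"
      by (simp add: g_def entering_def mult_neg_pos)
    then show ?thesis
      using g_nonneg[of "Suc t"] tT by (simp add: Suc_ile_eq)
  qed

  obtain Bd where Bd: "is_basis A Bd" "ss = reduced_cost A c Bd"
    using assms(6) by (auto simp: dual_basic_solution_def)
  have "\<exists>j. 0 < x t $ j \<and> ss \<bullet> x t \<le> real CARD('m) * (ss $ j * x t $ j)" if "t \<in> C" for t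
    using dominant_index[OF xbfs[OF CT[OF that]], of ss] gpos[OF that] gs[OF CT[OF that]] by metis
  then obtain h where h: "\<And>t. t \<in> C \<Longrightarrow> 0 < x t $ h t"
    and dom: "\<And>t. t \<in> C \<Longrightarrow> ss \<bullet> x t \<le> real CARD('m) * (ss $ h t * x t $ h t)"
    by metis
  have hJ: "h ` C \<subseteq> - Bd"
  proof (clarsimp)
    fix t
    assume t: "t \<in> C" and "h t \<in> Bd"
    then have "ss $ h t = 0"
      using reduced_cost_basic[OF Bd(1)] Bd(2) by simp
    then show False
      using dom[OF t] gpos[OF t] gs[OF CT[OF t]] by simp
  qed
  have ratio: "1 / w * g s \<le> g t" if "s \<in> C" "t \<in> C" "h s = h t" for s t
    using gap_ratio_at_common_index[OF xbfs[OF CT[OF that(1)]] xbfs[OF CT[OF that(2)]] s_nonneg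
        dom[OF that(1)] h[OF that(1)]] h[OF that(2)] that(3)
    by (simp add: gs[OF CT[OF that(1)]] gs[OF CT[OF that(2)]] w_def \<gamma>_def \<delta>_def)

  have side: "0 \<le> 1 - p" "1 - p \<le> 1" "finite (- Bd)" "\<And>t. t \<in> C \<Longrightarrow> enat t < T"
    using p by (simp_all add: C_def)
  have finC: "finite C"
    by (rule card_contracting_steps_le(1)[where T = T and g = g and h = h and J = "- Bd" and K = K];
        rule gmono contr side gpos hJ ratio qK; assumption)
  have cardC: "card C \<le> card (- Bd) * K"
    by (rule card_contracting_steps_le(2)[where T = T and g = g and h = h and J = "- Bd" and K = K];
        rule gmono contr side gpos hJ ratio qK; assumption)
  have gen: "generated_bfs A b x\<^sub>0 T Bs \<subseteq> (\<lambda>t. x (Suc t)) ` C"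
    using values_subset_jumps[of x T] unfolding generated_bfs_def x0 C_def by (simp add: x_def)
  have "card (generated_bfs A b x\<^sub>0 T Bs) \<le> card (- Bd) * K"
    using card_mono[OF _ gen] card_image_le[OF finC] finC cardC
    by (meson finite_imageI order.trans)
  then have "int (card (generated_bfs A b x\<^sub>0 T Bs)) \<le> int (card (- Bd)) * int K"
    by (metis of_nat_le_iff of_nat_mult)
  moreover have "int (card (- Bd)) = int CARD('n) - int CARD('m)"
    using Bd(1) assms(1) by (simp add: is_basis_def Compl_eq_Diff_UNIV card_Diff_subset)
  moreover have "r = real CARD('m) * bfs_max A b / (column_ratio A * bfs_min A b)
      * ln (real CARD('m) * bfs_max A b / bfs_min A b)"
    by (simp add: r_def p_def w_def \<beta>_def \<gamma>_def \<delta>_def)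
  ultimately show ?thesis
    using K finite_subset[OF gen] finC by simp
qed

end
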